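(* Let $n,m,p,N\in\mathbb{N}_+$, $B\in\mathbb{R}^{n\times m}$, $C\in\mathbb{R}^{p\times n}$ of full column rank, $x_0\in\mathbb{R}^n$, $r_1,\dots,r_N\in\mathbb{R}^p$, $r_0:=Cx_0$, $\lambda_1,\lambda_2,\lambda_3\ge0$, functions $f_1,f_2,f_3$ and a set $\mathcal{S}\subseteq\mathbb{R}^{n\times n}\times\mathbb{R}^{m\times N}\times\mathbb{R}_+$. Consider problem (AMOPUL): minimize $\lambda_1f_1(A)+\lambda_2f_2(U)+\lambda_3f_3(\omega)$ over $A\in\mathbb{R}^{n\times n}$, $U=(u_0,\dots,u_{N-1})\in\mathbb{R}^{m\times N}$, $\omega\in\mathbb{R}_+$ subject to $\sum_{t=1}^N\|CAC^{\dagger}r_{t-1}+CBu_{t-1}-r_t\|_2\le\omega$ and $(A,U,\omega)\in\mathcal{S}$. Suppose there exist $\beta>0$ and $\omega^{\rm u}>0$ such that $\|CA^{\rm a}C^{\dagger}\|_2\le\beta$ and $\omega^{\rm a}\le\omega^{\rm u}$ for every feasible solution $(A^{\rm a},U^{\rm a},\omega^{\rm a})$ of (AMOPUL). Then for each optimal solution $(A^{\rm a*},U^{\rm a*},\omega^{\rm a*})$ of (AMOPUL), with $U^{\rm a*}=(u^{\rm a*}_0,\dots,u^{\rm a*}_{N-1})$, defining $x_t=A^{\rm a*}x_{t-1}+Bu^{\rm a*}_{t-1}$ and $y_t=Cx_t$ for $t=1,\dots,N$, we have $$\sum_{t=1}^N\|y_t-r_t\|_2\le\Big(\sum_{i=0}^{N-1}\beta^i\Big)\omega^{\rm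 u}.$$
   Context: $C^{\dagger}$ is the Moore–Penrose inverse of $C$; $\|\cdot\|_2$ denotes the Euclidean norm for vectors and the spectral norm (largest singular value) for matrices. In the paper $f_1,f_2,f_3$ and $\mathcal{S}$ are assumed SD representable (convex and expressible by linear matrix inequalities), though this is not used in the claim. *)

theory Defs
  imports "HOL-Analysis.Analysis"
begin

text \<open>Moore--Penrose inverse: the unique matrix X satisfying the four Penrose equations.\<close>
definition moore_penrose :: "real^'n^'p \<Rightarrow> real^'p^'n" where
  "moore_penrose C = (THE X. C ** X ** C = C \<and> X ** C ** X = X \<and>
      transpose (C ** X) = C ** X \<and> transpose (X ** C) = X ** C)"

text \<open>Spectral norm = operator norm induced by the Euclidean norm.\<close>
definition spec_norm :: "real^'n^'m \<Rightarrow> real" where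
  "spec_norm M = onorm (\<lambda>v. M *v v)"

text \<open>Problem (AMOPUL). U = (u_0,...,u_{N-1}) is a list of length N (U ! t = u_t).\<close>
definition amopul_feasible ::
  "nat \<Rightarrow> real^'m^'n \<Rightarrow> real^'n^'p \<Rightarrow> (nat \<Rightarrow> real^'p)
   \<Rightarrow> ((real^'n^'n) \<times> (real^'m) list \<times> real) set
   \<Rightarrow> real^'n^'n \<Rightarrow> (real^'m) list \<Rightarrow> real \<Rightarrow> bool" where
  "amopul_feasible N B C r S A U \<omega> \<longleftrightarrow>
     length U = N \<and> \<omega> \<ge> 0 \<and>
     (\<Sum>t=1..N. norm ((C ** A ** moore_penrose C) *v r (t-1) + (C ** B) *v (U ! (t-1)) - r t)) \<le> \<omega> \<and>
     (A, U, \<omega>) \<in> S"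

definition amopul_obj ::
  "real \<Rightarrow> real \<Rightarrow> real \<Rightarrow> (real^'n^'n \<Rightarrow> real) \<Rightarrow> ((real^'m) list \<Rightarrow> real) \<Rightarrow> (real \<Rightarrow> real)
   \<Rightarrow> real^'n^'n \<Rightarrow> (real^'m) list \<Rightarrow> real \<Rightarrow> real" where
  "amopul_obj l1 l2 l3 f1 f2 f3 A U \<omega> = l1 * f1 A + l2 * f2 U + l3 * f3 \<omega>"

definition amopul_optimal where
  "amopul_optimal N B C r S l1 l2 l3 f1 f2 f3 A U \<omega> \<longleftrightarrow>
     amopul_feasible N B C r S A U \<omega> \<and>
     (\<forall>A' U' \<omega>'. amopul_feasible N B C r S A' U' \<omega>' \<longrightarrow>
        amopul_obj l1 l2 l3 f1 f2 f3 A U \<omega> \<le> amopul_obj l1 l2 l3 f1 f2 f3 A' U' \<omega>')"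

text \<open>State trajectory x_0 = x0, x_t = A x_{t-1} + B u_{t-1}.\<close>
fun traj :: "real^'n^'n \<Rightarrow> real^'m^'n \<Rightarrow> (real^'m) list \<Rightarrow> real^'n \<Rightarrow> nat \<Rightarrow> real^'n" where
  "traj A B U x0 0 = x0"
| "traj A B U x0 (Suc t) = A *v traj A B U x0 t + B *v (U ! t)"

end

theory Submission
  imports Defs
begin

(* Since C has full column rank, its Moore-Penrose inverse is a left inverse of C. Hence the
   output error e_t = C x_t - r_t obeys e_(t+1) = (C A C^+) e_t + d_t, where d_t is the t-th
   summand of the tracking constraint of (AMOPUL), and e_0 = 0 because r_0 = C x_0. This gives
   |e_(t+1)| <= beta |e_t| + |d_t|, and unrolling the recursion bounds the total error by
   (sum_(i<N) beta^i) * sum_t |d_t| <= (sum_(i<N) beta^i) * omega* <= (sum_(i<N) beta^i) * omega^u.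
   Optimality of the solution is only used through its feasibility. *)

lemma sum_le_geometric_sum_if_linear_recursive_bound:
  fixes a b :: "nat \<Rightarrow> real"
  assumes "\<beta> \<ge> 0" and "\<And>t. a (Suc t) \<le> \<beta> * a t + b t" and "\<And>t. b t \<ge> 0"
  shows "(\<Sum>t<N. a (Suc t)) \<le> (\<Sum>i<N. \<beta> ^ i) * (\<beta> * a 0 + (\<Sum>t<N. b t))"
  using assms(2,3)
proof (induction N arbitrary: a b)
  case 0
  then show ?case by simp
next
  case (Suc N)
  define G where "G = (\<Sum>i<N. \<beta> ^ i)"
  define R where "R = (\<Sum>t<N. b (Suc t))"
  have G_Suc: "(\<Sum>i<Suc N. \<beta> ^ i) = 1 + \<beta> * G"
    unfolding G_def by (simp add: sum.lessThan_Suc_shift sum_distrib_left del: sum.lessThan_Suc)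
  have "G \<le> 1 + \<beta> * G"
    using G_Suc zero_le_power[OF assms(1), of N] unfolding G_def by simp
  have "G \<ge> 0" "R \<ge> 0"
    unfolding G_def R_def using Suc.prems(2) assms(1) by (auto intro!: sum_nonneg)
  with \<open>G \<le> 1 + \<beta> * G\<close> have "G * R \<le> (1 + \<beta> * G) * R" "1 + \<beta> * G \<ge> 0"
    using assms(1) by (auto intro: mult_right_mono)
  have "(\<Sum>t<Suc N. a (Suc t)) = a 1 + (\<Sum>t<N. a (Suc (Suc t)))"
    by (simp add: sum.lessThan_Suc_shift del: sum.lessThan_Suc)
  also have "\<dots> \<le> a 1 + G * (\<beta> * a 1 + R)"
    using Suc.IH[of "\<lambda>t. a (Suc t)" "\<lambda>t. b (Suc t)"] Suc.prems unfolding G_def R_def by simp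
  also have "\<dots> = (1 + \<beta> * G) * a 1 + G * R"
    by (simp add: algebra_simps)
  also have "\<dots> \<le> (1 + \<beta> * G) * (\<beta> * a 0 + b 0) + (1 + \<beta> * G) * R"
    using Suc.prems(1)[of 0] \<open>1 + \<beta> * G \<ge> 0\<close> \<open>G * R \<le> (1 + \<beta> * G) * R\<close>
    by (intro add_mono mult_left_mono) auto
  also have "\<dots> = (\<Sum>i<Suc N. \<beta> ^ i) * (\<beta> * a 0 + (\<Sum>t<Suc N. b t))"
    unfolding G_Suc R_def by (simp add: sum.lessThan_Suc_shift algebra_simps del: sum.lessThan_Suc)
  finally show ?case .
qed

definition penrose_inverse :: "'a::comm_semiring_1^'n^'p \<Rightarrow> 'a^'p^'n \<Rightarrow> bool" where
  "penrose_inverse C X \<longleftrightarrow> C ** X ** C = C \<and> X ** C ** X = X \<and>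
      transpose (C ** X) = C ** X \<and> transpose (X ** C) = X ** C"

lemma penrose_inverse_unique:
  fixes C :: "'a::comm_semiring_1^'n^'p"
  assumes X: "penrose_inverse C X" and Y: "penrose_inverse C Y"
  shows "X = Y"
proof -
  have CX: "transpose X ** transpose C = C ** X" and XC: "transpose C ** transpose X = X ** C"
   and CY: "transpose Y ** transpose C = C ** Y" and YC: "transpose C ** transpose Y = Y ** C"
    using X Y unfolding penrose_inverse_def by (simp_all add: matrix_transpose_mul)
  have "transpose C = transpose (C ** Y ** C)"
    using Y unfolding penrose_inverse_def by simp
  also have "\<dots> = transpose C ** C ** Y"
    by (simp add: matrix_transpose_mul matrix_mul_assoc CY)
  finally have Ct_right: "transpose C = transpose C ** C ** Y" .
  have "transpose C = transpose (C ** X ** C)"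
    using X unfolding penrose_inverse_def by simp
  also have "\<dots> = X ** C ** transpose C"
    by (simp add: matrix_transpose_mul matrix_mul_assoc XC)
  finally have Ct_left: "transpose C = X ** C ** transpose C" .
  have "X = X ** (C ** X)"
    using X unfolding penrose_inverse_def by (simp add: matrix_mul_assoc)
  also have "\<dots> = X ** transpose X ** transpose C"
    by (simp add: CX flip: matrix_mul_assoc)
  also have "\<dots> = X ** (transpose X ** transpose C) ** C ** Y"
    by (subst Ct_right) (simp add: matrix_mul_assoc)
  also have "\<dots> = X ** C ** Y"
    using X unfolding penrose_inverse_def by (simp add: CX matrix_mul_assoc)
  finally have X_eq: "X = X ** C ** Y" .
  have "Y = (Y ** C) ** Y"
    using Y unfolding penrose_inverse_def by simp
  also have "\<dots> = transpose C ** transpose Y ** Y"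
    by (simp add: YC)
  also have "\<dots> = X ** C ** (transpose C ** transpose Y) ** Y"
    by (subst Ct_left) (simp add: matrix_mul_assoc)
  also have "\<dots> = X ** C ** Y"
    using Y unfolding penrose_inverse_def by (simp add: YC flip: matrix_mul_assoc)
  finally show "X = Y"
    using X_eq by simp
qed

lemma moore_penrose_eqI:
  assumes "penrose_inverse C X"
  shows "moore_penrose C = X"
  unfolding moore_penrose_def penrose_inverse_def[symmetric]
  using assms penrose_inverse_unique by blast

lemma penrose_inverse_left_inverse:
  fixes C :: "'a::field^'n^'p"
  assumes "penrose_inverse C X" and "inj ((*v) C)"
  shows "X ** C = mat 1"
proof -
  obtain L where L: "L ** C = mat 1"
    using assms(2) matrix_left_invertible_injective by blast
  have "X ** C = L ** (C ** X ** C)"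
    by (simp add: L matrix_mul_assoc)
  with assms(1) L show ?thesis
    unfolding penrose_inverse_def by simp
qed

lemma gram_matrix_left_invertible:
  fixes C :: "real^'n^'p"
  assumes "inj ((*v) C)"
  shows "\<exists>H. H ** (transpose C ** C) = mat 1"
  unfolding matrix_left_invertible_ker
proof (intro allI impI)
  fix v
  assume "(transpose C ** C) *v v = 0"
  then have "(C *v v) v* C = 0"
    by (simp flip: transpose_matrix_vector add: matrix_vector_mul_assoc)
  then have "inner (C *v v) (C *v v) = 0"
    by (simp flip: dot_lmul_matrix)
  then have "C *v v = C *v 0"
    by simp
  with assms show "v = 0"
    by (rule injD)
qed

lemma ex_penrose_inverse_if_inj:
  fixes C :: "real^'n^'p"
  assumes "inj ((*v) C)"
  shows "\<exists>X. penrose_inverse C X"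
proof -
  define G where "G = transpose C ** C"
  obtain H where HG: "H ** G = mat 1"
    using gram_matrix_left_invertible[OF assms] unfolding G_def by blast
  then have GH: "G ** H = mat 1"
    by (simp add: matrix_left_right_inverse)
  have "transpose G = G"
    unfolding G_def by (simp add: matrix_transpose_mul)
  then have "transpose H = transpose H ** (G ** H)"
    using GH by simp
  also have "\<dots> = transpose (G ** H) ** H"
    by (simp add: matrix_transpose_mul matrix_mul_assoc \<open>transpose G = G\<close>)
  finally have H_symmetric: "transpose H = H"
    using GH by simp
  define X where "X = H ** transpose C"
  have XC: "X ** C = mat 1"
    unfolding X_def using HG G_def by (simp add: matrix_mul_assoc)
  have "penrose_inverse C X"
    unfolding penrose_inverse_def
  proof (intro conjI)
    show "C ** X ** C = C" "X ** C ** X = X" "transpose (X ** C) = X ** C"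
      using XC by (simp_all flip: matrix_mul_assoc)
    show "transpose (C ** X) = C ** X"
      unfolding X_def by (simp add: matrix_transpose_mul H_symmetric matrix_mul_assoc)
  qed
  then show ?thesis ..
qed

lemma moore_penrose_left_inverse:
  fixes C :: "real^'n^'p"
  assumes "rank C = CARD('n)"
  shows "moore_penrose C ** C = mat 1"
proof -
  have "inj ((*v) C)"
    using assms full_rank_injective by blast
  moreover obtain X where "penrose_inverse C X"
    using ex_penrose_inverse_if_inj[OF \<open>inj ((*v) C)\<close>] ..
  ultimately show ?thesis
    using moore_penrose_eqI penrose_inverse_left_inverse by metis
qed

lemma norm_matrix_vector_le_spec_norm: "norm (M *v v) \<le> spec_norm M * norm v"
  unfolding spec_norm_def by (rule onorm[OF matrix_vector_mul_bounded_linear])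

lemma traj_output_error_Suc:
  assumes "K ** C = mat 1"
  shows "C *v traj A B U x0 (Suc t) - r (Suc t) =
    (C ** A ** K) *v (C *v traj A B U x0 t - r t) +
    ((C ** A ** K) *v r t + (C ** B) *v (U ! t) - r (Suc t))"
proof -
  have "C *v (A *v x) = (C ** A ** K) *v (C *v x)" for x
    using assms by (simp add: matrix_vector_mul_assoc flip: matrix_mul_assoc)
  then show ?thesis
    by (simp add: matrix_vector_mul_assoc[symmetric] algebra_simps)
qed

lemma norm_traj_output_error_Suc_le:
  assumes "K ** C = mat 1"
  shows "norm (C *v traj A B U x0 (Suc t) - r (Suc t)) \<le>
    spec_norm (C ** A ** K) * norm (C *v traj A B U x0 t - r t) +
    norm ((C ** A ** K) *v r t + (C ** B) *v (U ! t) - r (Suc t))"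
proof -
  let ?e = "C *v traj A B U x0 t - r t"
  have "norm (C *v traj A B U x0 (Suc t) - r (Suc t)) \<le>
      norm ((C ** A ** K) *v ?e) + norm ((C ** A ** K) *v r t + (C ** B) *v (U ! t) - r (Suc t))"
    unfolding traj_output_error_Suc[OF assms] by (rule norm_triangle_ineq)
  then show ?thesis
    using norm_matrix_vector_le_spec_norm[of "C ** A ** K" ?e] by linarith
qed

theorem theorem2:
  fixes N :: nat
    and B :: "real^'m^'n" and C :: "real^'n^'p" and x0 :: "real^'n"
    and r :: "nat \<Rightarrow> real^'p"
    and l1 l2 l3 :: real
    and f1 :: "real^'n^'n \<Rightarrow> real" and f2 :: "(real^'m) list \<Rightarrow> real" and f3 :: "real \<Rightarrow> real"
    and S :: "((real^'n^'n) \<times> (real^'m) list \<times> real) set"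
    and \<beta> \<omega>u :: real
    and As :: "real^'n^'n" and Us :: "(real^'m) list" and \<omega>s :: real
  assumes "N > 0"
    and "rank C = CARD('n)"
    and "r 0 = C *v x0"
    and "l1 \<ge> 0" and "l2 \<ge> 0" and "l3 \<ge> 0"
    and "\<beta> > 0" and "\<omega>u > 0"
    and "\<And>A U \<omega>. amopul_feasible N B C r S A U \<omega> \<Longrightarrow>
           spec_norm (C ** A ** moore_penrose C) \<le> \<beta> \<and> \<omega> \<le> \<omega>u"
    and "amopul_optimal N B C r S l1 l2 l3 f1 f2 f3 As Us \<omega>s"
  shows "(\<Sum>t=1..N. norm (C *v traj As B Us x0 t - r t)) \<le> (\<Sum>i<N. \<beta> ^ i) * \<omega>u"
proof -
  have feasible: "amopul_feasible N B C r S As Us \<omega>s"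
    using assms(10) unfolding amopul_optimal_def by blast
  define M where "M = C ** As ** moore_penrose C"
  define e where "e t = C *v traj As B Us x0 t - r t" for t
  define d where "d t = M *v r t + (C ** B) *v (Us ! t) - r (Suc t)" for t
  have "spec_norm M \<le> \<beta>" and "\<omega>s \<le> \<omega>u"
    using assms(9)[OF feasible] unfolding M_def by auto
  have residuals: "(\<Sum>t<N. norm (d t)) \<le> \<omega>s"
    using feasible unfolding amopul_feasible_def d_def M_def by (simp add: sum.atLeast1_atMost_eq)
  have "norm (e (Suc t)) \<le> \<beta> * norm (e t) + norm (d t)" for t
  proof -
    have "norm (e (Suc t)) \<le> spec_norm M * norm (e t) + norm (d t)"
      unfolding e_def d_def M_def
      by (rule norm_traj_output_error_Suc_le[OF moore_penrose_left_inverse[OF assms(2)]])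
    also have "\<dots> \<le> \<beta> * norm (e t) + norm (d t)"
      using \<open>spec_norm M \<le> \<beta>\<close> by (simp add: mult_right_mono)
    finally show ?thesis .
  qed
  with assms(7) have "(\<Sum>t<N. norm (e (Suc t))) \<le>
      (\<Sum>i<N. \<beta> ^ i) * (\<beta> * norm (e 0) + (\<Sum>t<N. norm (d t)))"
    by (intro sum_le_geometric_sum_if_linear_recursive_bound) auto
  also have "\<dots> \<le> (\<Sum>i<N. \<beta> ^ i) * \<omega>u"
    using assms(3,7) residuals \<open>\<omega>s \<le> \<omega>u\<close> unfolding e_def
    by (intro mult_left_mono) (auto intro: sum_nonneg)
  finally show ?thesis
    unfolding e_def by (simp add: sum.atLeast1_atMost_eq)
qed

end
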